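(* Consider the quadratic program $(QP)$ described in the context, with $Ax=b$ solvable, together with the associated extended-real values $D$, $TL^{x}$, $TL^{X}$, $PL^{X}$ and $PL^{x}$ defined there. (1) If $PL^{x}=-\infty$, then $D=TL^{x}=TL^{X}=PL^{X}=PL^{x}=-\infty$. (2) If $PL^{x}\ne-\infty$, let $\mu^*\in\mathcal M$ be an optimal multiplier for $PL^{x}$, i.e. $PL^{x}(\mu^* )=PL^{x}$. If there exists $\nu^*\in\mathbb{R}^{\bar p}$ such that $Q_{\mu^*,\nu^*}\succeq0$ (i.e. the redundant constraints convexify the partial Lagrangian at $\mu^*$), then $PL^{X}=PL^{x}$, and consequently $D=TL^{x}=TL^{X}=PL^{X}=PL^{x}$.
   Context: Notation: $M\cdot N=\sum_{i,j}M_{ij}N_{ij}$; $M\succeq0$ means symmetric positive semidefinite; infima/suprema are taken in $[-\infty,+\infty]$, with $\inf\emptyset=+\infty$, $\sup\emptyset=-\infty$. Data: $n\ge1$; symmetric $Q,B_1,\dots,B_p,\overline B_1,\dots,\overline B_{\bar p}\in\mathbb{R}^{n\times n}$; $c,d_1,\dots,d_p,\bar d_1,\dots,\bar d_{\bar p}\in\mathbb{R}^n$; $e\in\mathbb{R}^p$, $\bar e\in\mathbb{R}^{\bar p}$; $A\in\mathbb{R}^{q\times n}$, $b\in\mathbb{R}^q$. The program is $$(QP)\ \min_{x\in\mathbb{R}^n}\ Q\cdot xx^\top+c^\top x\ \text{ s.t. } Ax=b;\ \overline B_j\cdot xx^\top+\bar d_j^\top x=\bar e_j\ (1\le j\le\bar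 p);\ B_i\cdot xx^\top+d_i^\top x=e_i\ \text{or}\le e_i\ (1\le i\le p),$$ where each constraint $i$ is a fixed choice of equality or inequality. The constraints indexed by $j$ are redundant: they hold for every $x$ with $Ax=b$. Multipliers: $\mathcal M=\{\mu\in\mathbb{R}^p:\mu_i\ge0\text{ whenever constraint } i \text{ is an inequality}\}$. For $\mu\in\mathcal M$, $\nu\in\mathbb{R}^{\bar p}$ put $Q_{\mu,\nu}=Q+\sum_i\mu_iB_i+\sum_j\nu_j\overline B_j$, $c_{\mu,\nu}=c+\sum_i\mu_id_i+\sum_j\nu_j\bar d_j$, $\kappa_{\mu,\nu}=\mu^\top e+\nu^\top\bar e$. Partial Lagrangian in $x$: $PL^{x}(\mu)=\inf\{Q_{\mu,0}\cdot xx^\top+c_{\mu,0}^\top x-\mu^\top e:\ x\in\mathbb{R}^n,\ Ax=b\}$ and $PL^{x}=\sup_{\mu\in\mathcal M}PL^{x}(\mu)$. Partial Lagrangian in $X$: $PL^{X}=\sup_{\mu\in\mathcal M,\nu}\inf\{Q_{\mu,\nu}\cdot X+c_{\mu,\nu}^\top x-\kappa_{\mu,\nu}:\ Ax=b,\ \begin{bmatrix}1 & x^\top \\ x & X\end{bmatrix}\succeq0\}$. Total Lagrangians: $TL^{x}=\sup_{\mu\in\mathcal M,\nu,\beta\in\mathbb{R}^q}\inf_{x\in\mathbb{R}^n}\{Q_{\mu,\nu}\cdot xx^\top+(c_{\mu,\nu}+A^\top\beta)^\top x-\kappa_{\mu,\nu}-\beta^\top b\}$, and $TL^{X}$ is the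 same with $xx^\top$ replaced by $X$ and the infimum over all $(x,X)$ with $\begin{bmatrix}1 & x^\top \\ x & X\end{bmatrix}\succeq0$. $D$ is the optimum value of the dual of the SDP relaxation of $(QP)$ (obtained by replacing $xx^\top$ by $X$ with $\begin{bmatrix}1 & x^\top \\ x & X\end{bmatrix}\succeq0$): $$D=\sup\Big\{t-\kappa_{\mu,\nu}-\beta^\top b:\ t\in\mathbb{R},\mu\in\mathcal M,\nu\in\mathbb{R}^{\bar p},\beta\in\mathbb{R}^q,\ \begin{bmatrix}-t & \tfrac12(c_{\mu,\nu}+A^\top\beta)^\top \\ \tfrac12(c_{\mu,\nu}+A^\top\beta) & Q_{\mu,\nu}\end{bmatrix}\succeq0\Big\}.$$ *)

theory Defs
  imports "HOL-Analysis.Analysis"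
begin

text \<open>
  Index families are functions on \<open>nat\<close> of which only the entries below the stated
  length matter; the lengths may be \<open>0\<close>. Likewise, multiplier vectors are
  functions \<open>nat \<Rightarrow> real\<close> whose entries beyond the relevant length are never used. The order
  of variables is \<open>n = CARD('n)\<close>, which is at least 1.
\<close>

record 'n qp =
  Qobj :: "real^'n^'n"
  cobj :: "real^'n"
  ncon :: nat                        \<comment> \<open>\<open>p\<close>\<close>
  Bcon :: "nat \<Rightarrow> real^'n^'n"
  dcon :: "nat \<Rightarrow> real^'n"
  econ :: "nat \<Rightarrow> real"
  ineq :: "nat \<Rightarrow> bool"              \<comment> \<open>constraint \<open>i\<close> reads \<open>\<le> e\<^sub>i\<close> if \<open>ineq i\<close>, else \<open>= e\<^sub>i\<close>\<close>
  nred :: nat                        \<comment> \<open>\<open>p\<close> bar: number of redundant constraints\<close>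
  Bred :: "nat \<Rightarrow> real^'n^'n"
  dred :: "nat \<Rightarrow> real^'n"
  ered :: "nat \<Rightarrow> real"
  nrow :: nat                        \<comment> \<open>\<open>q\<close>: number of rows of \<open>A\<close>\<close>
  Arow :: "nat \<Rightarrow> real^'n"
  brhs :: "nat \<Rightarrow> real"

text \<open>The inner product \<open>\<bullet>\<close> on \<open>real^'n^'n\<close> is the entrywise one, \<open>M \<cdot> N\<close>.\<close>

definition outer :: "real^'n \<Rightarrow> real^'n^'n" where
  "outer x = (\<chi> i j. x $ i * x $ j)"

definition psd :: "real^'m^'m \<Rightarrow> bool" where
  "psd M \<longleftrightarrow> transpose M = M \<and> (\<forall>v. 0 \<le> v \<bullet> (M *v v))"

text \<open>The bordered matrix with corner \<open>s\<close>, border \<open>u\<close> and block \<open>M\<close>; \<open>None\<close> indexes the extra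
  first row and column.\<close>

definition bordered :: "real \<Rightarrow> real^'n \<Rightarrow> real^'n^'n \<Rightarrow> real^('n option)^('n option)" where
  "bordered s u M = (\<chi> i j.
     case i of
       None \<Rightarrow> (case j of None \<Rightarrow> s | Some l \<Rightarrow> u $ l)
     | Some k \<Rightarrow> (case j of None \<Rightarrow> u $ k | Some l \<Rightarrow> M $ k $ l))"

definition affine_feasible :: "'n::finite qp \<Rightarrow> (real^'n) set" where
  "affine_feasible P = {x. \<forall>k<nrow P. Arow P k \<bullet> x = brhs P k}"

definition redundant_constraints :: "'n::finite qp \<Rightarrow> bool" where
  "redundant_constraints P \<longleftrightarrow>
     (\<forall>x\<in>affine_feasible P. \<forall>j<nred P. Bred P j \<bullet> outer x + dred P j \<bullet> x = ered P j)"

definition multipliers :: "'n::finite qp \<Rightarrow> (nat \<Rightarrow> real) set" where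
  "multipliers P = {\<mu>. \<forall>i<ncon P. ineq P i \<longrightarrow> 0 \<le> \<mu> i}"

definition Qmult :: "'n::finite qp \<Rightarrow> (nat \<Rightarrow> real) \<Rightarrow> (nat \<Rightarrow> real) \<Rightarrow> real^'n^'n" where
  "Qmult P \<mu> \<nu> = Qobj P + (\<Sum>i<ncon P. \<mu> i *\<^sub>R Bcon P i) + (\<Sum>j<nred P. \<nu> j *\<^sub>R Bred P j)"

definition cmult :: "'n::finite qp \<Rightarrow> (nat \<Rightarrow> real) \<Rightarrow> (nat \<Rightarrow> real) \<Rightarrow> real^'n" where
  "cmult P \<mu> \<nu> = cobj P + (\<Sum>i<ncon P. \<mu> i *\<^sub>R dcon P i) + (\<Sum>j<nred P. \<nu> j *\<^sub>R dred P j)"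

definition \<kappa>mult :: "'n::finite qp \<Rightarrow> (nat \<Rightarrow> real) \<Rightarrow> (nat \<Rightarrow> real) \<Rightarrow> real" where
  "\<kappa>mult P \<mu> \<nu> = (\<Sum>i<ncon P. \<mu> i * econ P i) + (\<Sum>j<nred P. \<nu> j * ered P j)"

definition ATmult :: "'n::finite qp \<Rightarrow> (nat \<Rightarrow> real) \<Rightarrow> real^'n" where
  "ATmult P \<beta> = (\<Sum>k<nrow P. \<beta> k *\<^sub>R Arow P k)"

definition bmult :: "'n::finite qp \<Rightarrow> (nat \<Rightarrow> real) \<Rightarrow> real" where
  "bmult P \<beta> = (\<Sum>k<nrow P. \<beta> k * brhs P k)"

definition partial_lagr ::
  "'n::finite qp \<Rightarrow> (nat \<Rightarrow> real) \<Rightarrow> (nat \<Rightarrow> real) \<Rightarrow> real^'n \<Rightarrow> real^'n^'n \<Rightarrow> real" where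
  "partial_lagr P \<mu> \<nu> x X = Qmult P \<mu> \<nu> \<bullet> X + cmult P \<mu> \<nu> \<bullet> x - \<kappa>mult P \<mu> \<nu>"

definition total_lagr ::
  "'n::finite qp \<Rightarrow> (nat \<Rightarrow> real) \<Rightarrow> (nat \<Rightarrow> real) \<Rightarrow> (nat \<Rightarrow> real) \<Rightarrow> real^'n \<Rightarrow> real^'n^'n \<Rightarrow> real"
  where
  "total_lagr P \<mu> \<nu> \<beta> x X =
     Qmult P \<mu> \<nu> \<bullet> X + (cmult P \<mu> \<nu> + ATmult P \<beta>) \<bullet> x - \<kappa>mult P \<mu> \<nu> - bmult P \<beta>"

definition PLx_at :: "'n::finite qp \<Rightarrow> (nat \<Rightarrow> real) \<Rightarrow> ereal" where
  "PLx_at P \<mu> = (INF x\<in>affine_feasible P. ereal (partial_lagr P \<mu> (\<lambda>_. 0) x (outer x)))"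

definition PLx :: "'n::finite qp \<Rightarrow> ereal" where
  "PLx P = (SUP \<mu>\<in>multipliers P. PLx_at P \<mu>)"

definition PLX :: "'n::finite qp \<Rightarrow> ereal" where
  "PLX P = (SUP (\<mu>, \<nu>)\<in>multipliers P \<times> UNIV.
     INF (x, X)\<in>{(x, X). x \<in> affine_feasible P \<and> psd (bordered 1 x X)}.
       ereal (partial_lagr P \<mu> \<nu> x X))"

definition TLx :: "'n::finite qp \<Rightarrow> ereal" where
  "TLx P = (SUP (\<mu>, \<nu>, \<beta>)\<in>multipliers P \<times> UNIV \<times> UNIV.
     INF x. ereal (total_lagr P \<mu> \<nu> \<beta> x (outer x)))"

definition TLX :: "'n::finite qp \<Rightarrow> ereal" where
  "TLX P = (SUP (\<mu>, \<nu>, \<beta>)\<in>multipliers P \<times> UNIV \<times> UNIV.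
     INF (x, X)\<in>{(x, X). psd (bordered 1 x X)}. ereal (total_lagr P \<mu> \<nu> \<beta> x X))"

definition sdp_dual :: "'n::finite qp \<Rightarrow> ereal" where
  "sdp_dual P = Sup {ereal (t - \<kappa>mult P \<mu> \<nu> - bmult P \<beta>) | t \<mu> \<nu> \<beta>.
     \<mu> \<in> multipliers P \<and>
     psd (bordered (- t) ((1/2) *\<^sub>R (cmult P \<mu> \<nu> + ATmult P \<beta>)) (Qmult P \<mu> \<nu>))}"

end

(*
  Testing the dual matrix inequality against the vectors (1, x) and against psd bordered matrices
  gives D = TLx = TLX, and restricting the infima gives TLX <= PLX <= PLx. To close the cycle at
  a mu with Q_{mu,nu} psd: on {Ax = b} the redundant terms vanish, so the partial Lagrangian is
  a convex quadratic bounded below there; it has a minimiser, its gradient at the minimiser is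
  some -A^T beta, and this beta makes the total Lagrangian at least PLx(mu) on all of R^n.
*)
theory Submission
  imports Defs
begin

section \<open>Quadratic forms as inner products with rank-one matrices\<close>

lemma inner_outer: "M \<bullet> outer v = v \<bullet> (M *v v)"
  by (simp add: inner_vec_def outer_def matrix_vector_mult_def sum_distrib_left mult_ac)

lemma psd_iff: "psd M \<longleftrightarrow> transpose M = M \<and> (\<forall>v. 0 \<le> M \<bullet> outer v)"
  by (simp add: psd_def inner_outer)

lemma sum_option: "(\<Sum>i\<in>(UNIV :: 'n::finite option set). f i) = f None + (\<Sum>k\<in>UNIV. f (Some k))"
  by (simp add: UNIV_option_conv sum.reindex)

lemma inner_bordered:
  "bordered s u M \<bullet> bordered s' u' M' = s * s' + 2 * (u \<bullet> u') + M \<bullet> M'"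
  by (simp add: bordered_def inner_vec_def sum_option sum.distrib)

text \<open>Block form of a rank-one matrix on the extended index set, so that
  \<open>inner_bordered\<close> evaluates bordered quadratic forms.\<close>

lemma outer_option: "outer v = bordered ((v $ None)\<^sup>2) (v $ None *\<^sub>R (\<chi> k. v $ Some k)) (outer (\<chi> k. v $ Some k))"
  by (auto simp: outer_def bordered_def vec_eq_iff power2_eq_square split: option.split)

lemma transpose_bordered: "transpose (bordered s u M) = bordered s u (transpose M)"
  by (auto simp: transpose_def bordered_def vec_eq_iff split: option.split)

lemma inner_matrix_symmetric:
  fixes M :: "real^'m^'m"
  assumes "transpose M = M"
  shows "a \<bullet> (M *v b) = (M *v a) \<bullet> b"
  by (metis assms dot_lmul_matrix transpose_matrix_vector)

lemma inner_outer_add: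
  fixes M :: "real^'m^'m"
  assumes "transpose M = M"
  shows "M \<bullet> outer (a + b) = M \<bullet> outer a + 2 * ((M *v a) \<bullet> b) + M \<bullet> outer b"
  using inner_matrix_symmetric[OF assms, of a b]
  by (simp add: inner_outer matrix_vector_right_distrib inner_add inner_commute)

lemma outer_scaleR: "outer (r *\<^sub>R v) = r\<^sup>2 *\<^sub>R outer v"
  by (simp add: outer_def vec_eq_iff power2_eq_square)

section \<open>Elimination along coordinate axes and the inner product of psd matrices\<close>

lemma inner_outer_axis: "M \<bullet> outer (axis k 1) = M $ k $ k"
  by (simp add: inner_outer matrix_vector_mul_component inner_axis inner_axis')

lemma matrix_mul_axis: "(M :: real^'m^'m) *v axis k 1 = column k M"
  by (simp add: matrix_vector_mult_basis)

lemma psd_diag: "psd M \<Longrightarrow> 0 \<le> M $ k $ k"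
  by (metis inner_outer_axis psd_iff)

lemma symmetric_component: "transpose M = M \<Longrightarrow> M $ i $ j = M $ j $ i"
  by (metis transpose_def vec_lambda_beta)

lemma column_symmetric: "transpose M = M \<Longrightarrow> column k M = M $ k"
  by (simp add: column_def vec_eq_iff symmetric_component[of M])

lemma inner_outer_axis_add:
  assumes "transpose M = M"
  shows "M \<bullet> outer (\<tau> *\<^sub>R axis k 1 + v) = \<tau>\<^sup>2 * M $ k $ k + 2 * \<tau> * (M $ k \<bullet> v) + M \<bullet> outer v"
  by (simp add: inner_outer_add assms outer_scaleR inner_outer_axis matrix_vector_mult_scaleR
      matrix_mul_axis column_symmetric)

lemma outer_inner_outer: "outer u \<bullet> outer v = (u \<bullet> v)\<^sup>2"
  by (simp add: inner_vec_def outer_def power2_eq_square sum_product mult_ac)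

text \<open>A Schur complement: its form at \<open>v\<close> is the minimum over real \<tau> of the
  form of \<open>N\<close> at \<tau> times the \<open>k\<close>-th unit vector plus
  \<open>v\<close>.\<close>

lemma psd_diff_outer_row:
  assumes "psd N" and "N $ k $ k \<noteq> 0"
  shows "psd (N - (1 / N $ k $ k) *\<^sub>R outer (N $ k))"
  unfolding psd_iff
proof (intro conjI allI)
  have sym: "transpose N = N" using assms(1) by (simp add: psd_iff)
  show "transpose (N - (1 / N $ k $ k) *\<^sub>R outer (N $ k)) = N - (1 / N $ k $ k) *\<^sub>R outer (N $ k)"
    using symmetric_component[OF sym] by (simp add: transpose_def vec_eq_iff outer_def mult_ac)
  fix v
  \<comment> \<open>The minimiser of that quadratic in \<tau>.\<close>
  define \<tau> where "\<tau> = - (N $ k \<bullet> v) / N $ k $ k"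
  have "0 \<le> N \<bullet> outer (\<tau> *\<^sub>R axis k 1 + v)" using assms(1) by (simp add: psd_iff)
  also have "\<dots> = N \<bullet> outer v - (N $ k \<bullet> v)\<^sup>2 / N $ k $ k"
    using assms(2) unfolding inner_outer_axis_add[OF sym]
    by (simp add: \<tau>_def field_simps power2_eq_square)
  finally show "0 \<le> (N - (1 / N $ k $ k) *\<^sub>R outer (N $ k)) \<bullet> outer v"
    by (simp add: inner_diff_left outer_inner_outer)
qed

text \<open>With zero diagonal, the form at \<tau> times the \<open>i\<close>-th plus the
  \<open>j\<close>-th unit vector is linear in \<tau>; both signs of \<tau> force the entry to
  vanish.\<close>

lemma psd_zero_diag_imp_zero:
  assumes "psd N" and "\<And>k. N $ k $ k = 0"
  shows "N = 0"
proof -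
  have sym: "transpose N = N" using assms(1) by (simp add: psd_iff)
  have "N $ i $ j = 0" for i j
  proof -
    have "0 \<le> N \<bullet> outer (\<tau> *\<^sub>R axis i 1 + axis j 1)" for \<tau>
      using assms(1) by (simp add: psd_iff)
    then have *: "0 \<le> 2 * \<tau> * N $ i $ j" for \<tau>
      by (simp add: inner_outer_axis_add sym assms(2) inner_outer_axis inner_axis)
    show ?thesis using *[of 1] *[of "-1"] by simp
  qed
  then show ?thesis by (simp add: vec_eq_iff)
qed

text \<open>Cholesky elimination: subtracting \<open>outer (N $ k) / N $ k $ k\<close> clears the \<open>k\<close>-th diagonal
  entry of \<open>N\<close>, so induction on the number of nonzero diagonal entries writes \<open>N\<close> as a
  nonnegative combination of outer products.\<close>

lemma psd_inner_nonneg: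
  assumes "psd M" and "psd N"
  shows "0 \<le> M \<bullet> N"
  using assms(2)
proof (induction "card {k. N $ k $ k \<noteq> 0}" arbitrary: N rule: less_induct)
  case less
  show ?case
  proof (cases "\<exists>k. N $ k $ k \<noteq> 0")
    case False
    then have "N = 0" using less.prems psd_zero_diag_imp_zero by blast
    then show ?thesis by simp
  next
    case True
    then obtain k where k: "N $ k $ k \<noteq> 0" by blast
    define N' where "N' = N - (1 / N $ k $ k) *\<^sub>R outer (N $ k)"
    have N': "psd N'" unfolding N'_def using less.prems k by (rule psd_diff_outer_row)
    have pos: "0 < N $ k $ k" using psd_diag[OF less.prems, of k] k by simp
    have diag: "N' $ j $ j = N $ j $ j - (N $ k $ j)\<^sup>2 / N $ k $ k" for j
      by (simp add: N'_def outer_def power2_eq_square)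
    \<comment> \<open>Elimination never increases a diagonal entry, and \<open>N'\<close> is psd, so
      a zero entry stays zero.\<close>
    have "N' $ j $ j = 0" if "N $ j $ j = 0" for j
      using psd_diag[OF N', of j] diag[of j] that pos
      by (metis antisym diff_0 divide_nonneg_pos neg_le_0_iff_le zero_le_power2)
    moreover have "N' $ k $ k = 0" using k by (simp add: diag power2_eq_square)
    ultimately have "{j. N' $ j $ j \<noteq> 0} \<subset> {j. N $ j $ j \<noteq> 0}" using k by blast
    then have "0 \<le> M \<bullet> N'" using less.hyps N' by (simp add: psubset_card_mono)
    moreover have "N = N' + (1 / N $ k $ k) *\<^sub>R outer (N $ k)" by (simp add: N'_def)
    then have "M \<bullet> N = M \<bullet> N' + M \<bullet> outer (N $ k) / N $ k $ k"
      by (metis inner_add_right inner_scaleR_right mult_1 times_divide_eq_left)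
    ultimately show ?thesis using assms(1) pos by (simp add: psd_iff)
  qed
qed

section \<open>Bordered matrices and lower bounds of quadratics\<close>

lemma bordered_outer: "bordered 1 x (outer x) = outer (\<chi> i. case i of None \<Rightarrow> 1 | Some k \<Rightarrow> x $ k)"
  by (simp add: outer_option)

lemma psd_outer: "psd (outer x)"
  unfolding psd_iff outer_inner_outer by (simp add: transpose_def outer_def mult_ac)

lemma psd_bordered_outer: "psd (bordered 1 x (outer x))"
  by (simp add: bordered_outer psd_outer)

text \<open>Pairs the dual slack matrix with a primal matrix; the border is counted twice, which
  cancels the half.\<close>

lemma inner_bordered_half:
  "bordered (- t) ((1/2) *\<^sub>R c) Q \<bullet> bordered 1 x X = Q \<bullet> X + c \<bullet> x - t"
  by (simp add: inner_bordered)

text \<open>Homogenisation: at a vector (s, y) with s nonzero the form is s squared times the gap in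
  \<open>lb\<close> at y/s; s = 0 is a limit case.\<close>

lemma quadratic_nonneg_imp_psd_bordered:
  fixes Q :: "real^'n^'n"
  assumes sym: "transpose Q = Q" and lb: "\<And>x. t \<le> Q \<bullet> outer x + c \<bullet> x"
  shows "psd (bordered (- t) ((1/2) *\<^sub>R c) Q)"
  unfolding psd_iff
proof (intro conjI allI)
  show "transpose (bordered (- t) ((1/2) *\<^sub>R c) Q) = bordered (- t) ((1/2) *\<^sub>R c) Q"
    by (simp add: transpose_bordered sym)
  fix v :: "real^('n option)"
  define s where "s = v $ None"
  define y where "y = (\<chi> k. v $ Some k)"
  have v: "outer v = bordered (s\<^sup>2) (s *\<^sub>R y) (outer y)"
    unfolding s_def y_def by (rule outer_option)
  have eq: "bordered (- t) ((1/2) *\<^sub>R c) Q \<bullet> outer v = Q \<bullet> outer y + s * (c \<bullet> y) - s\<^sup>2 * t"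
    by (simp add: v inner_bordered)
  have nonzero: "0 \<le> Q \<bullet> outer y + r * (c \<bullet> y) - r\<^sup>2 * t" if "r \<noteq> 0" for r
  proof -
    have "r\<^sup>2 * t \<le> r\<^sup>2 * (Q \<bullet> outer ((1/r) *\<^sub>R y) + c \<bullet> ((1/r) *\<^sub>R y))"
      by (intro mult_left_mono lb) simp
    also have "\<dots> = Q \<bullet> outer y + r * (c \<bullet> y)"
      using that by (simp add: outer_scaleR field_simps power2_eq_square)
    finally show ?thesis by simp
  qed
  \<comment> \<open>The case s = 0, obtained by letting r tend to 0 in
    \<open>nonzero\<close>.\<close>
  have "0 \<le> Q \<bullet> outer y"
  proof (rule tendsto_lowerbound)
    show "((\<lambda>r. Q \<bullet> outer y + r * (c \<bullet> y) - r\<^sup>2 * t) \<longlongrightarrow> Q \<bullet> outer y) (at 0)"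
      by (rule tendsto_eq_intros refl | simp)+
    show "\<forall>\<^sub>F r in at 0. 0 \<le> Q \<bullet> outer y + r * (c \<bullet> y) - r\<^sup>2 * t"
      using nonzero by (auto simp: eventually_at_filter)
  qed simp
  then show "0 \<le> bordered (- t) ((1/2) *\<^sub>R c) Q \<bullet> outer v"
    unfolding eq using nonzero[of s] by (cases "s = 0") auto
qed

section \<open>Lagrangians and the chain of inequalities\<close>

lemma transpose_Qmult:
  assumes "transpose (Qobj P) = Qobj P"
    and "\<forall>i<ncon P. transpose (Bcon P i) = Bcon P i"
    and "\<forall>j<nred P. transpose (Bred P j) = Bred P j"
  shows "transpose (Qmult P \<mu> \<nu>) = Qmult P \<mu> \<nu>"
  using assms by (simp add: Qmult_def transpose_def vec_eq_iff)

lemma total_lagr_eq: "total_lagr P \<mu> \<nu> \<beta> x X = partial_lagr P \<mu> \<nu> x X + ATmult P \<beta> \<bullet> x - bmult P \<beta>"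
  by (simp add: total_lagr_def partial_lagr_def inner_add_left)

lemma ATmult_inner_feasible: "x \<in> affine_feasible P \<Longrightarrow> ATmult P \<beta> \<bullet> x = bmult P \<beta>"
  by (simp add: ATmult_def bmult_def affine_feasible_def inner_sum_left)

lemma partial_lagr_redundant:
  assumes "redundant_constraints P" and "x \<in> affine_feasible P"
  shows "partial_lagr P \<mu> \<nu> x (outer x) = partial_lagr P \<mu> (\<lambda>_. 0) x (outer x)"
proof -
  have "(\<Sum>j<nred P. \<nu> j * ered P j) = (\<Sum>j<nred P. \<nu> j * (Bred P j \<bullet> outer x + dred P j \<bullet> x))"
    using assms by (auto simp: redundant_constraints_def intro!: sum.cong)
  then show ?thesis
    by (simp add: partial_lagr_def Qmult_def cmult_def \<kappa>mult_def inner_add_left inner_sum_left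
        distrib_left sum.distrib)
qed

text \<open>Weak duality: two psd matrices have nonnegative inner product, so a dual feasible
  \<open>t\<close> bounds the Lagrangian from below.\<close>

lemma sdp_dual_le_TLX: "sdp_dual P \<le> TLX P"
  unfolding sdp_dual_def
proof (rule Sup_least, clarify)
  fix t \<mu> \<nu> \<beta>
  assume \<mu>: "\<mu> \<in> multipliers P"
    and psd: "psd (bordered (- t) ((1/2) *\<^sub>R (cmult P \<mu> \<nu> + ATmult P \<beta>)) (Qmult P \<mu> \<nu>))"
  have "t - \<kappa>mult P \<mu> \<nu> - bmult P \<beta> \<le> total_lagr P \<mu> \<nu> \<beta> x X" if "psd (bordered 1 x X)" for x X
    using psd_inner_nonneg[OF psd that] unfolding inner_bordered_half by (simp add: total_lagr_def)
  then show "ereal (t - \<kappa>mult P \<mu> \<nu> - bmult P \<beta>) \<le> TLX P"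
    unfolding TLX_def using \<mu> by (intro SUP_upper2[where i = "(\<mu>, \<nu>, \<beta>)"]) (auto intro!: INF_greatest)
qed

lemma TLX_le_TLx: "TLX P \<le> TLx P"
  unfolding TLX_def TLx_def
  by (intro SUP_mono) (force intro!: INF_mono simp: psd_bordered_outer)

text \<open>On the affine set the \<beta> terms cancel, so the infimum is merely restricted to a
  smaller set.\<close>

lemma TLX_le_PLX: "TLX P \<le> PLX P"
  unfolding TLX_def PLX_def
proof (rule SUP_least, clarify)
  fix \<mu> \<nu> \<beta> assume "\<mu> \<in> multipliers P"
  then show "(INF (x, X)\<in>{(x, X). psd (bordered 1 x X)}. ereal (total_lagr P \<mu> \<nu> \<beta> x X))
    \<le> (SUP (\<mu>, \<nu>)\<in>multipliers P \<times> UNIV. INF (x, X)\<in>{(x, X). x \<in> affine_feasible P \<and> psd (bordered 1 x X)}.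
       ereal (partial_lagr P \<mu> \<nu> x X))"
    by (intro SUP_upper2[where i = "(\<mu>, \<nu>)"])
      (force intro!: INF_mono simp: total_lagr_eq ATmult_inner_feasible)+
qed

text \<open>The choice \<open>X = outer x\<close> is admissible, and there the \<nu> terms
  cancel.\<close>

lemma PLX_le_PLx:
  assumes "redundant_constraints P"
  shows "PLX P \<le> PLx P"
  unfolding PLX_def PLx_def PLx_at_def
proof (rule SUP_least, clarify)
  fix \<mu> \<nu> assume "\<mu> \<in> multipliers P"
  then show "(INF (x, X)\<in>{(x, X). x \<in> affine_feasible P \<and> psd (bordered 1 x X)}.
       ereal (partial_lagr P \<mu> \<nu> x X))
    \<le> (SUP \<mu>\<in>multipliers P. INF x\<in>affine_feasible P. ereal (partial_lagr P \<mu> (\<lambda>_. 0) x (outer x)))"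
    by (intro SUP_upper2[where i = \<mu>])
      (force intro!: INF_mono simp: psd_bordered_outer partial_lagr_redundant[OF assms, symmetric, of _ _ \<nu>])+
qed

text \<open>Turns a uniform lower bound on a total Lagrangian into a dual feasible point of value
  \<open>r\<close>.\<close>

lemma sdp_dual_ge:
  assumes sym: "transpose (Qmult P \<mu> \<nu>) = Qmult P \<mu> \<nu>" and \<mu>: "\<mu> \<in> multipliers P"
    and lb: "\<And>x. r \<le> total_lagr P \<mu> \<nu> \<beta> x (outer x)"
  shows "ereal r \<le> sdp_dual P"
proof -
  define t where "t = r + \<kappa>mult P \<mu> \<nu> + bmult P \<beta>"
  have "psd (bordered (- t) ((1/2) *\<^sub>R (cmult P \<mu> \<nu> + ATmult P \<beta>)) (Qmult P \<mu> \<nu>))"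
  proof (rule quadratic_nonneg_imp_psd_bordered[OF sym])
    show "t \<le> Qmult P \<mu> \<nu> \<bullet> outer x + (cmult P \<mu> \<nu> + ATmult P \<beta>) \<bullet> x" for x
      using lb[of x] by (simp add: t_def total_lagr_def)
  qed
  moreover have "r = t - \<kappa>mult P \<mu> \<nu> - bmult P \<beta>" by (simp add: t_def)
  ultimately show ?thesis
    unfolding sdp_dual_def using \<mu> by (blast intro: Sup_upper)
qed

lemma TLx_le_sdp_dual:
  assumes sym: "\<And>\<mu> \<nu>. transpose (Qmult P \<mu> \<nu>) = Qmult P \<mu> \<nu>"
  shows "TLx P \<le> sdp_dual P"
  unfolding TLx_def
proof (rule SUP_least, clarify)
  fix \<mu> \<nu> \<beta> assume \<mu>: "\<mu> \<in> multipliers P"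
  show "(INF x. ereal (total_lagr P \<mu> \<nu> \<beta> x (outer x))) \<le> sdp_dual P" (is "?I \<le> _")
  proof (cases ?I)
    case (real r)
    have "r \<le> total_lagr P \<mu> \<nu> \<beta> x (outer x)" for x
      unfolding ereal_less_eq(3)[symmetric] real[symmetric] by (rule INF_lower) simp
    then show ?thesis unfolding real by (rule sdp_dual_ge[OF sym \<mu>])
  next
    \<comment> \<open>Impossible: the value at the origin is finite.\<close>
    case PInf
    have "?I \<le> ereal (total_lagr P \<mu> \<nu> \<beta> 0 (outer 0))" by (rule INF_lower) simp
    then show ?thesis using PInf by simp
  qed simp
qed

section \<open>Closing the chain under convexification\<close>

text \<open>The gradient \<open>2 Q x\<^sub>0 + c\<close> is split along \<open>Q K + K\<^sup>\<bottom>\<close>, where \<open>K = ker A\<close>. The residual \<open>r\<close> lies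
  in \<open>K\<close> with \<open>r \<bullet> Q r = 0\<close>, so the objective is affine with slope \<open>r \<bullet> r\<close> along \<open>r\<close>, and
  boundedness below forces \<open>r = 0\<close>.\<close>

lemma convex_quadratic_multiplier:
  fixes P :: "'n::finite qp"
  assumes psd: "psd Q" and x0: "x0 \<in> affine_feasible P"
    and lb: "\<And>x. x \<in> affine_feasible P \<Longrightarrow> t \<le> Q \<bullet> outer x + c \<bullet> x"
  shows "\<exists>\<beta>. \<forall>x. t \<le> Q \<bullet> outer x + c \<bullet> x + ATmult P \<beta> \<bullet> x - bmult P \<beta>"
proof -
  have sym: "transpose Q = Q" using psd by (simp add: psd_iff)
  define K where "K = {z. \<forall>k<nrow P. Arow P k \<bullet> z = 0}"
  have K_add: "x0 + z \<in> affine_feasible P" if "z \<in> K" for z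
    using that x0 by (simp add: K_def affine_feasible_def inner_add_right)
  have K_sub: "subspace K"
    by (auto simp: K_def subspace_def inner_add_right)
  define S where "S = {Q *v z + ATmult P \<beta> | z \<beta>. z \<in> K}"
  have SI: "Q *v z + ATmult P \<beta> \<in> S" if "z \<in> K" for z \<beta>
    using that by (auto simp: S_def)
  have S_sub: "subspace S"
    unfolding subspace_def
  proof (intro conjI ballI allI)
    show "0 \<in> S"
      using SI[of 0 "\<lambda>_. 0"] subspace_0[OF K_sub] by (simp add: ATmult_def)
    fix a assume "a \<in> S"
    then obtain z \<beta> where a: "a = Q *v z + ATmult P \<beta>" "z \<in> K" by (auto simp: S_def)
    show "r *\<^sub>R a \<in> S" for r
      using SI[OF subspace_scale[OF K_sub a(2)], of r "\<lambda>k. r * \<beta> k"]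
      by (simp add: a ATmult_def scaleR_right_distrib scaleR_sum_right matrix_vector_mult_scaleR)
    fix b assume "b \<in> S"
    then obtain z' \<beta>' where b: "b = Q *v z' + ATmult P \<beta>'" "z' \<in> K" by (auto simp: S_def)
    show "a + b \<in> S"
      using SI[OF subspace_add[OF K_sub a(2) b(2)], of "\<lambda>k. \<beta> k + \<beta>' k"]
      by (simp add: a b ATmult_def scaleR_left_distrib sum.distrib matrix_vector_right_distrib algebra_simps)
  qed
  define g where "g = 2 *\<^sub>R (Q *v x0) + c"
  obtain s r where "s \<in> span S" and orth: "\<And>w. w \<in> span S \<Longrightarrow> orthogonal r w" and g: "g = s + r"
    using orthogonal_subspace_decomp_exists by blast
  then have s: "s \<in> S" using S_sub by (simp add: span_eq_iff[THEN iffD2])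
  have orth: "r \<bullet> w = 0" if "w \<in> S" for w
    using orth[OF span_base[OF that]] by (simp add: orthogonal_def)
  have rK: "r \<in> K"
  proof -
    \<comment> \<open>Each row lies in \<open>S\<close>: take z = 0 and a unit multiplier.\<close>
    have "r \<bullet> Arow P k = 0" if "k < nrow P" for k
    proof -
      have "(\<Sum>i<nrow P. (if i = k then 1 else 0) *\<^sub>R Arow P i) = Arow P k"
        using that by (simp add: if_distrib[of "\<lambda>a. a *\<^sub>R _"] cong: if_cong)
      then show ?thesis
        using orth[OF SI[OF subspace_0[OF K_sub]], of "\<lambda>i. if i = k then 1 else 0"]
        by (simp add: ATmult_def)
    qed
    then show ?thesis by (simp add: K_def inner_commute)
  qed
  \<comment> \<open>As \<open>r\<close> is in \<open>K\<close>, the vector \<open>Q *v r\<close>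
    lies in \<open>S\<close>, hence is orthogonal to \<open>r\<close>.\<close>
  have rQr: "Q \<bullet> outer r = 0"
    using orth[OF SI[OF rK], of "\<lambda>_. 0"] by (simp add: inner_outer ATmult_def)
  have "t \<le> Q \<bullet> outer x0 + c \<bullet> x0 + \<tau> * (r \<bullet> r)" for \<tau>
  proof -
    have "t \<le> Q \<bullet> outer (x0 + \<tau> *\<^sub>R r) + c \<bullet> (x0 + \<tau> *\<^sub>R r)"
      by (intro lb K_add subspace_scale[OF K_sub] rK)
    also have "\<dots> = Q \<bullet> outer x0 + c \<bullet> x0 + \<tau> * (g \<bullet> r)"
      by (simp add: inner_outer_add sym outer_scaleR rQr g_def inner_add_left inner_add_right algebra_simps)
    also have "g \<bullet> r = r \<bullet> r"
      using orth[OF s] by (simp add: g inner_add_left inner_commute[of s])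
    finally show ?thesis .
  qed
  \<comment> \<open>For nonzero \<open>r\<close> this \<tau> makes the right-hand side
    \<open>t - 1\<close>, a contradiction.\<close>
  from this[of "(t - 1 - (Q \<bullet> outer x0 + c \<bullet> x0)) / (r \<bullet> r)"] have "r = 0"
    by (cases "r = 0") simp_all
  with s g obtain z \<beta> where z: "z \<in> K" and gz: "g = Q *v z + ATmult P \<beta>"
    by (auto simp: S_def)
  \<comment> \<open>Moving by -z/2 changes the gradient by \<open>- Q *v z\<close>, leaving only
    \<open>ATmult P \<beta>\<close>; so \<open>x'\<close> is a feasible minimiser.\<close>
  define x' where "x' = x0 + (-1/2) *\<^sub>R z"
  have x': "x' \<in> affine_feasible P"
    unfolding x'_def by (intro K_add subspace_scale[OF K_sub] z)
  have grad: "2 *\<^sub>R (Q *v x') + c = ATmult P \<beta>"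
    using gz by (simp add: x'_def g_def matrix_vector_right_distrib matrix_vector_mult_scaleR algebra_simps)
  \<comment> \<open>The sign change makes the gradient of the Lagrangian vanish at
    \<open>x'\<close>.\<close>
  define \<gamma> where "\<gamma> = (\<lambda>k. - \<beta> k)"
  have \<gamma>: "ATmult P \<gamma> = - ATmult P \<beta>" "bmult P \<gamma> = - bmult P \<beta>"
    by (simp_all add: \<gamma>_def ATmult_def bmult_def sum_negf)
  show ?thesis
  proof (intro exI allI)
    fix x
    have "t \<le> Q \<bullet> outer x' + c \<bullet> x'" by (rule lb[OF x'])
    \<comment> \<open>Adds the second-order remainder of the exact expansion about
      \<open>x'\<close>, nonnegative by convexity.\<close>
    also have "\<dots> \<le> Q \<bullet> outer x' + c \<bullet> x' + Q \<bullet> outer (x - x')"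
      using psd by (simp add: psd_iff)
    also have "\<dots> = Q \<bullet> outer x + c \<bullet> x - (2 *\<^sub>R (Q *v x') + c) \<bullet> (x - x')"
      using inner_outer_add[OF sym, of x' "x - x'"] by (simp add: inner_add_left inner_diff_right)
    also have "\<dots> = Q \<bullet> outer x + c \<bullet> x + ATmult P \<gamma> \<bullet> x - bmult P \<gamma>"
      unfolding grad by (simp add: \<gamma> inner_diff_right ATmult_inner_feasible[OF x'])
    finally show "t \<le> Q \<bullet> outer x + c \<bullet> x + ATmult P \<gamma> \<bullet> x - bmult P \<gamma>" .
  qed
qed

text \<open>The finite bound \<open>PLx_at P \<mu>\<close> also holds for the convexified Lagrangian
  on the affine set; \<open>convex_quadratic_multiplier\<close> extends it to all \<open>x\<close>,
  and \<open>sdp_dual_ge\<close> applies.\<close>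

lemma PLx_at_le_sdp_dual:
  assumes "redundant_constraints P" and "affine_feasible P \<noteq> {}"
    and \<mu>: "\<mu> \<in> multipliers P" and psd: "psd (Qmult P \<mu> \<nu>)"
  shows "PLx_at P \<mu> \<le> sdp_dual P"
proof (cases "PLx_at P \<mu>")
  case (real r)
  obtain x0 where x0: "x0 \<in> affine_feasible P" using assms(2) by blast
  have "r + \<kappa>mult P \<mu> \<nu> \<le> Qmult P \<mu> \<nu> \<bullet> outer x + cmult P \<mu> \<nu> \<bullet> x" if "x \<in> affine_feasible P" for x
  proof -
    have "ereal r \<le> ereal (partial_lagr P \<mu> (\<lambda>_. 0) x (outer x))"
      unfolding real[symmetric] PLx_at_def by (rule INF_lower[OF that])
    then show ?thesis
      using partial_lagr_redundant[OF assms(1) that, of \<mu> \<nu>] by (simp add: partial_lagr_def)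
  qed
  then obtain \<beta> where
    "\<forall>x. r + \<kappa>mult P \<mu> \<nu> \<le> Qmult P \<mu> \<nu> \<bullet> outer x + cmult P \<mu> \<nu> \<bullet> x + ATmult P \<beta> \<bullet> x - bmult P \<beta>"
    using convex_quadratic_multiplier[OF psd x0] by blast
  then have "r \<le> total_lagr P \<mu> \<nu> \<beta> x (outer x)" for x
    by (simp add: total_lagr_def inner_add_left algebra_simps)
  with psd \<mu> show ?thesis
    unfolding real by (intro sdp_dual_ge) (auto simp: psd_iff)
next
  case PInf
  obtain x0 where "x0 \<in> affine_feasible P" using assms(2) by blast
  then have "PLx_at P \<mu> \<le> ereal (partial_lagr P \<mu> (\<lambda>_. 0) x0 (outer x0))"
    unfolding PLx_at_def by (rule INF_lower)
  then show ?thesis using PInf by simp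
qed simp

theorem proposition2:
  fixes P :: "'n::finite qp"
  assumes "transpose (Qobj P) = Qobj P"
    and "\<forall>i<ncon P. transpose (Bcon P i) = Bcon P i"
    and "\<forall>j<nred P. transpose (Bred P j) = Bred P j"
    and "redundant_constraints P"
    and "affine_feasible P \<noteq> {}"
  shows
    "(PLx P = -\<infinity> \<longrightarrow>
        sdp_dual P = -\<infinity> \<and> TLx P = -\<infinity> \<and> TLX P = -\<infinity> \<and> PLX P = -\<infinity>) \<and>
     (PLx P \<noteq> -\<infinity> \<longrightarrow>
        (\<forall>\<mu>\<in>multipliers P. PLx_at P \<mu> = PLx P \<longrightarrow> (\<exists>\<nu>. psd (Qmult P \<mu> \<nu>)) \<longrightarrow>
           PLX P = PLx P \<and>
           sdp_dual P = TLx P \<and> TLx P = TLX P \<and> TLX P = PLX P))"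
proof -
  have sym: "transpose (Qmult P \<mu> \<nu>) = Qmult P \<mu> \<nu>" for \<mu> \<nu>
    using assms(1-3) by (rule transpose_Qmult)
  have D: "sdp_dual P = TLX P" and T: "TLx P = TLX P"
    using sdp_dual_le_TLX[of P] TLX_le_TLx[of P] TLx_le_sdp_dual[of P, OF sym] by auto
  have "PLx P = sdp_dual P"
    if "\<mu> \<in> multipliers P" "PLx_at P \<mu> = PLx P" "psd (Qmult P \<mu> \<nu>)" for \<mu> \<nu>
    using PLx_at_le_sdp_dual[OF assms(4,5) that(1,3)] that(2)
      sdp_dual_le_TLX[of P] TLX_le_PLX[of P] PLX_le_PLx[OF assms(4)] by simp
  \<comment> \<open>If \<open>PLx P\<close> is minus infinity, the chain below it gives the first
    claim; otherwise the equality just shown closes the cycle.\<close>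
  with D T TLX_le_PLX[of P] PLX_le_PLx[OF assms(4)] show ?thesis
    by (metis antisym ereal_infty_less_eq(2))
qed

end
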